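(* Let $k \geq 1$ be an integer and let $0<p<1$, $0<q<1$. In a Best-of-$(2k+1)$ game in which $A$ serves first, the probability $Pr_{SR}(A)$ that $A$ wins the game when it is played under the Standard Rule equals the probability $Pr_{CR}(A)$ that $A$ wins the game when it is played under the Catch-Up Rule: $$Pr_{SR}(A) = Pr_{CR}(A).$$
   Context: Two players $A$ and $B$ play a sequence of points. On each point exactly one player is the server, and exactly one of the two players wins the point (and scores one point). When $A$ serves, $A$ wins the point with probability $p$ (and $B$ wins it with probability $1-p$); when $B$ serves, $B$ wins the point with probability $q$ (and $A$ wins it with probability $1-q$). Here $q$ is not an abbreviation for $1-p$; $p$ and $q$ are unrelated parameters. The results of the serves are independent. $A$ always serves the first point. A Best-of-$(2k+1)$ game (Win-by-One) ends as soon as one player has scored $k+1$ points, and that player wins the game. Serving rules after the first point: under the Standard Rule ($SR$), the server of each subsequent point is the winner of the previous point. Under the Catch-Up Rule ($CR$), the server of each subsequent point is the loser of the previous point. *)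

theory Defs
  imports "HOL-Probability.Probability"
begin

datatype player = Player_A | Player_B

fun opponent :: "player \<Rightarrow> player" where
  "opponent Player_A = Player_B"
| "opponent Player_B = Player_A"

datatype serving_rule = Standard_Rule | Catch_Up_Rule

text \<open>The first argument is the rule, the second the winner of the previous point.\<close>

fun next_server :: "serving_rule \<Rightarrow> player \<Rightarrow> player" where
  "next_server Standard_Rule w = w"
| "next_server Catch_Up_Rule w = opponent w"

text \<open>
  A history is the list of the winners of the points played so far, most recent point first.
\<close>

fun server :: "serving_rule \<Rightarrow> player list \<Rightarrow> player" where
  "server r [] = Player_A"
| "server r (w # h) = next_server r w"

fun serve_win_prob :: "real \<Rightarrow> real \<Rightarrow> player \<Rightarrow> real" where
  "serve_win_prob p q Player_A = p"
| "serve_win_prob p q Player_B = q"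

definition point_winner :: "real \<Rightarrow> real \<Rightarrow> player \<Rightarrow> player pmf" where
  "point_winner p q s =
     map_pmf (\<lambda>server_wins. if server_wins then s else opponent s)
       (bernoulli_pmf (serve_win_prob p q s))"

definition wins_game :: "nat \<Rightarrow> player \<Rightarrow> player list \<Rightarrow> bool" where
  "wins_game k x h \<longleftrightarrow> count_list h x \<ge> k + 1"

text \<open>
  The distribution of the complete history of a Best-of-\<open>(2k+1)\<close> game that has reached the
  history \<open>h\<close>. Given \<open>h\<close>, the next point depends only on who serves it, which is the
  independence of the serves.
\<close>

function game :: "serving_rule \<Rightarrow> real \<Rightarrow> real \<Rightarrow> nat \<Rightarrow> player list \<Rightarrow> player list pmf" where
  "game r p q k h =
     (if wins_game k Player_A h \<or> wins_game k Player_B h then return_pmf h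
      else bind_pmf (point_winner p q (server r h)) (\<lambda>w. game r p q k (w # h)))"
  by pat_completeness auto
termination
proof (relation "Wellfounded.measure (\<lambda>(r, p, q, k, h).
    (k + 1 - count_list h Player_A) + (k + 1 - count_list h Player_B))")
  fix r :: serving_rule and p q :: real and k :: nat and h :: "player list" and w :: player
  assume "\<not> (wins_game k Player_A h \<or> wins_game k Player_B h)"
  then show "((r, p, q, k, w # h), (r, p, q, k, h)) \<in> Wellfounded.measure (\<lambda>(r, p, q, k, h).
    (k + 1 - count_list h Player_A) + (k + 1 - count_list h Player_B))"
    by (cases w) (auto simp: wins_game_def)
qed simp

text \<open>The defining equation of \<open>game\<close> loops as a rewrite rule.\<close>

declare game.simps [simp del]

definition prob_A_wins :: "serving_rule \<Rightarrow> real \<Rightarrow> real \<Rightarrow> nat \<Rightarrow> real" where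
  "prob_A_wins r p q k = measure_pmf.prob (game r p q k []) {h. wins_game k Player_A h}"

end

theory Submission
  imports Defs
begin

text \<open>
  Imagine that, before the game, the results of \<open>k + 1\<close> serves of \<open>A\<close> and of \<open>k\<close> serves of \<open>B\<close>
  are drawn independently, and that the game reads the next unused result of whoever serves.
  If no player ever runs out of prepared serves, the winner can be read off without knowing the
  order of the serves. Continue by playing out all unused serves. Altogether \<open>2 * k + 1\<close> points
  are played, so exactly one player reaches \<open>k + 1\<close> points; the winner of the game already has
  that many, so it is the same player. Hence \<open>A\<close> wins the game if and only if \<open>A\<close> takes at least
  \<open>k + 1\<close> of the \<open>2 * k + 1\<close> prepared points, and the probability of this event
  (\<open>pool_prob p q (k + 1) k (k + 1)\<close> below) does not mention the serving rule.

  It remains to see that the prepared serves suffice (\<open>serves_within_pool\<close>). Under the Standard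
  Rule each player serves once for every point won, up to an offset coming from the first serve
  and the serve about to take place; under the Catch-Up Rule, once for every point lost. As both
  scores are at most \<open>k\<close> until the game ends, and \<open>A\<close> has the one additional first serve, neither
  rule demands more than \<open>k + 1\<close> serves of \<open>A\<close> or \<open>k\<close> serves of \<open>B\<close>.

  The coupling is carried out as a backward induction over game histories
  (\<open>prob_A_wins_from_history\<close>): the probability that \<open>A\<close> wins from a given history is the
  probability that \<open>A\<close> takes enough of the serves left in the pool.
\<close>

text \<open>
  The probability that \<open>A\<close> takes at least \<open>n\<close> points when \<open>A\<close> serves \<open>i\<close> times and \<open>B\<close> serves
  \<open>j\<close> times, that is, the tail \<open>P (X + Y \<ge> n)\<close> of the sum of independent binomial variables with
  parameters \<open>(i, p)\<close> and \<open>(j, 1 - q)\<close>. The truncated subtraction is harmless: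
  a demand of \<open>0\<close> points stays satisfied.
\<close>

fun pool_prob :: "real \<Rightarrow> real \<Rightarrow> nat \<Rightarrow> nat \<Rightarrow> nat \<Rightarrow> real" where
  "pool_prob p q 0 0 n = (if n = 0 then 1 else 0)"
| "pool_prob p q 0 (Suc j) n = (1 - q) * pool_prob p q 0 j (n - 1) + q * pool_prob p q 0 j n"
| "pool_prob p q (Suc i) j n = p * pool_prob p q i j (n - 1) + (1 - p) * pool_prob p q i j n"

text \<open>
  The defining equations use up the serves of \<open>A\<close> first. That a serve of \<open>B\<close> may equally well be
  taken first is what makes the order of the serves, and with it the serving rule, irrelevant.
\<close>

lemma pool_prob_B_serves_first:
  "pool_prob p q i (Suc j) n = (1 - q) * pool_prob p q i j (n - 1) + q * pool_prob p q i j n"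
proof (induction i arbitrary: n)
  case (Suc i)
  show ?case
    by (simp only: pool_prob.simps Suc) (simp add: algebra_simps)
qed simp

lemma pool_prob_no_demand [simp]: "pool_prob p q i j 0 = 1"
  by (induction p q i j "0 :: nat" rule: pool_prob.induct) (simp_all add: algebra_simps)

lemma pool_prob_excessive_demand: "i + j < n \<Longrightarrow> pool_prob p q i j n = 0"
  by (induction p q i j n rule: pool_prob.induct) simp_all

fun serves :: "serving_rule \<Rightarrow> player \<Rightarrow> player list \<Rightarrow> nat" where
  "serves r x [] = 0"
| "serves r x (w # h) = serves r x h + (if server r h = x then 1 else 0)"

lemma serves_total: "serves r Player_A h + serves r Player_B h = length h"
  by (induction h) (auto intro: player.exhaust)

lemma points_total: "count_list h Player_A + count_list h Player_B = length h"
proof (induction h)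
  case (Cons w h)
  then show ?case by (cases w) auto
qed simp

text \<open>
  Under the Standard Rule every point won entitles to one later serve. If \<open>B\<close> is about to serve,
  that entitlement has not been used yet, and \<open>A\<close> has served the first point on top of the
  entitled serves; if \<open>A\<close> is about to serve, the first serve and the pending one cancel.
\<close>

lemma serves_Standard_Rule:
  "serves Standard_Rule Player_A h =
     count_list h Player_A + (if server Standard_Rule h = Player_B then 1 else 0)"
  "serves Standard_Rule Player_B h + (if server Standard_Rule h = Player_B then 1 else 0) =
     count_list h Player_B"
proof (induction h)
  case (Cons w h)
  { case 1 from Cons show ?case by (cases w; cases "server Standard_Rule h") auto }
  { case 2 from Cons show ?case by (cases w; cases "server Standard_Rule h") auto }
qed simp_all

text \<open>The same bookkeeping when it is each point lost that entitles to a serve.\<close>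

lemma serves_Catch_Up_Rule:
  "serves Catch_Up_Rule Player_A h =
     count_list h Player_B + (if server Catch_Up_Rule h = Player_B then 1 else 0)"
  "serves Catch_Up_Rule Player_B h + (if server Catch_Up_Rule h = Player_B then 1 else 0) =
     count_list h Player_A"
proof (induction h)
  case (Cons w h)
  { case 1 from Cons show ?case by (cases w; cases "server Catch_Up_Rule h") auto }
  { case 2 from Cons show ?case by (cases w; cases "server Catch_Up_Rule h") auto }
qed simp_all

text \<open>
  While the game is on, both scores are at most \<open>k\<close>, so the counts above leave room in the pool
  for the serve that is about to be played.
\<close>

lemma serves_within_pool:
  assumes "\<not> wins_game k Player_A h" and "\<not> wins_game k Player_B h"
  shows "serves r Player_A (w # h) \<le> k + 1" and "serves r Player_B (w # h) \<le> k"
  using assms serves_Standard_Rule[of h] serves_Catch_Up_Rule[of h]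
  by (cases r; cases "server r h"; simp add: wins_game_def)+

lemma prob_bind_point_winner:
  assumes "0 \<le> p" "p \<le> 1" "0 \<le> q" "q \<le> 1"
  shows "measure_pmf.prob (bind_pmf (point_winner p q s) f) S =
    serve_win_prob p q s * measure_pmf.prob (f s) S +
    (1 - serve_win_prob p q s) * measure_pmf.prob (f (opponent s)) S"
proof -
  have "0 \<le> serve_win_prob p q s" "serve_win_prob p q s \<le> 1"
    using assms by (cases s; simp)+
  then have "emeasure (bind_pmf (point_winner p q s) f) S =
      ennreal (serve_win_prob p q s * measure_pmf.prob (f s) S +
        (1 - serve_win_prob p q s) * measure_pmf.prob (f (opponent s)) S)"
    unfolding point_winner_def bind_map_pmf emeasure_bind_pmf
    by (simp add: measure_pmf.emeasure_eq_measure mult.commute flip: ennreal_plus ennreal_mult)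
  with \<open>0 \<le> serve_win_prob p q s\<close> \<open>serve_win_prob p q s \<le> 1\<close> show ?thesis
    by (simp del: emeasure_bind_pmf ennreal_plus add: measure_pmf.emeasure_eq_measure)
qed

text \<open>
  One step of the game consumes one serve from the pool, so the game and \<open>pool_prob\<close> obey the same
  recursion. The two bounds on the serves admit every history that a game passes through, and also
  its final history, although there the next server might have no serve left: a finished game is
  settled by the scores alone. As the induction measure, \<open>2 * k + 1 - length h\<close> is the number of
  serves left in the pool.
\<close>

lemma prob_A_wins_from_history:
  assumes pq: "0 \<le> p" "p \<le> 1" "0 \<le> q" "q \<le> 1"
    and "serves r Player_A h \<le> k + 1" and "serves r Player_B h \<le> k"
  shows "measure_pmf.prob (game r p q k h) {h. wins_game k Player_A h} =
    pool_prob p q (k + 1 - serves r Player_A h) (k - serves r Player_B h)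
      (k + 1 - count_list h Player_A)"
  using assms(5,6)
proof (induction h rule: measure_induct_rule[where f = "\<lambda>h. 2 * k + 1 - length h"])
  case (less h)
  let ?P = "\<lambda>h. measure_pmf.prob (game r p q k h) {h. wins_game k Player_A h}"
  consider (A_won) "wins_game k Player_A h"
    | (B_won) "\<not> wins_game k Player_A h" "wins_game k Player_B h"
    | (unfinished) "\<not> wins_game k Player_A h" "\<not> wins_game k Player_B h"
    by blast
  then show ?case
  proof cases
    case A_won
    then show ?thesis
      by (subst game.simps) (simp add: wins_game_def)
  next
    case B_won
    \<comment> \<open>Every point is somebody's serve, so \<open>B\<close>'s \<open>k + 1\<close> points leave one serve too few for \<open>A\<close>.\<close>
    have "(k + 1 - serves r Player_A h) + (k - serves r Player_B h) < k + 1 - count_list h Player_A"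
      using B_won less.prems serves_total[of r h] points_total[of h]
      unfolding wins_game_def by linarith
    with B_won show ?thesis
      by (subst game.simps) (simp add: pool_prob_excessive_demand)
  next
    case unfinished
    have IH: "?P (w # h) =
      pool_prob p q (k + 1 - serves r Player_A (w # h)) (k - serves r Player_B (w # h))
        (k + 1 - count_list (w # h) Player_A)" for w
    proof (rule less.IH)
      show "2 * k + 1 - length (w # h) < 2 * k + 1 - length h"
        using unfinished points_total[of h] by (simp add: wins_game_def)
    qed (use serves_within_pool[OF unfinished] in blast)+
    have step: "?P h = serve_win_prob p q (server r h) * ?P (server r h # h) +
      (1 - serve_win_prob p q (server r h)) * ?P (opponent (server r h) # h)"
      using unfinished pq by (subst game.simps) (simp add: prob_bind_point_winner)
    show ?thesis
    proof (cases "server r h")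
      case Player_A
      obtain i where "k + 1 - serves r Player_A h = Suc i"
        using serves_within_pool(1)[OF unfinished, of r Player_A] Player_A
        by (cases "k + 1 - serves r Player_A h") auto
      moreover from this have "k - serves r Player_A h = i" by simp
      ultimately show ?thesis
        unfolding step IH using Player_A by simp
    next
      case Player_B
      obtain j where "k - serves r Player_B h = Suc j"
        using serves_within_pool(2)[OF unfinished, of r Player_A] Player_B
        by (cases "k - serves r Player_B h") auto
      moreover from this have "k - Suc (serves r Player_B h) = j" by simp
      ultimately show ?thesis
        unfolding step IH using Player_B by (simp add: pool_prob_B_serves_first)
    qed
  qed
qed

corollary prob_A_wins_eq_pool_prob:
  assumes "0 \<le> p" "p \<le> 1" "0 \<le> q" "q \<le> 1"
  shows "prob_A_wins r p q k = pool_prob p q (k + 1) k (k + 1)"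
  unfolding prob_A_wins_def using assms by (subst prob_A_wins_from_history) simp_all

theorem theorem1:
  fixes p q :: real and k :: nat
  assumes "k \<ge> 1" and "0 < p" and "p < 1" and "0 < q" and "q < 1"
  shows "prob_A_wins Standard_Rule p q k = prob_A_wins Catch_Up_Rule p q k"
  using assms by (simp add: prob_A_wins_eq_pool_prob)

end
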